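(* $$\sum_{k=1}^{\infty}(6k-1)\frac{(-\frac12)_k^2}{4^k\,k!\,(\frac32)_k}\sum_{i=1}^{k}\frac{1}{(2i-1)^2}=\frac{\pi^3}{144}.$$
   Context: For a complex number $x$, the shifted factorial (Pochhammer symbol) is $(x)_0=1$ and $(x)_n=x(x+1)\cdots(x+n-1)$ for positive integers $n$. *)

theory Defs
  imports Complex_Main
begin

end

theory Submission
  imports Defs "HOL-Complex_Analysis.Complex_Analysis" "HOL-Real_Asymp.Real_Asymp"
begin

text \<open>
  Write \<open>c\<^sub>k = (1/2)\<^sub>k / k!\<close> and \<open>p\<^sub>k = c\<^sub>k \<Sum>\<^sub>i 1/(2i-1)\<^sup>2\<close>. The \<open>k\<close>-th summand is
  \<open>4\<^sup>-\<^sup>k p\<^sub>k (1/(2k-1) + 1/(2k-1)\<^sup>2 - 1/(2k+1))\<close>, and the \<open>p\<^sub>k\<close> are essentially the Taylor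
  coefficients of \<open>arcsin\<^sup>3\<close>. Substituting \<open>x = sin t\<close> and integrating by parts reduces the sum
  at \<open>x = 1/2\<close> to the log-sine integral of \<open>ln\<^sup>2 (2 sin t)\<close> over \<open>(0, \<pi>/6)\<close>, which equals
  \<open>7 \<pi>\<^sup>3 / 216\<close>. That value comes from a primitive \<open>F\<close> of \<open>Ln\<^sup>2 (1 - z) / z\<close> on the plane slit
  along \<open>[1, \<infinity>)\<close>: following \<open>F\<close> around the unit circle gives the integral over \<open>(0, \<pi>)\<close>,
  and following it along \<open>Re z = 1/2\<close> between the sixth roots of unity, where \<open>z\<close> and \<open>1 - z\<close>
  are conjugate, gives the integral over \<open>(\<pi>/6, 5\<pi>/6)\<close>.
\<close>

section \<open>The log-sine integral\<close>

text \<open>The slit plane is starlike about 0. The point 0 can be an exceptional point where only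
  continuity is required, since \<open>Ln (1 - z)\<close> vanishes there.\<close>

lemma log_sq_over_primitive:
  obtains F where "\<And>z. z \<notin> complex_of_real ` {1..} \<Longrightarrow>
    (F has_field_derivative (Ln (1 - z))\<^sup>2 / z) (at z)"
proof -
  let ?S = "- (complex_of_real ` {1..})"
  let ?f = "\<lambda>z. (Ln (1 - z))\<^sup>2 / z"
  have slit: "1 - z \<notin> \<real>\<^sub>\<le>\<^sub>0" if "z \<in> ?S" for z
  proof
    assume "1 - z \<in> \<real>\<^sub>\<le>\<^sub>0"
    then have "z = complex_of_real (Re z)" "Re z \<ge> 1"
      by (auto simp: complex_nonpos_Reals_iff complex_eq_iff)
    with that show False by (metis ComplD atLeast_iff image_eqI)
  qed
  have D: "((\<lambda>z. Ln (1 - z)) has_field_derivative - (1 / (1 - z))) (at z)" if "z \<in> ?S" for z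
    using slit[OF that] by (auto intro!: derivative_eq_intros simp: divide_simps)
  have op: "open ?S"
  proof -
    have "complex_of_real ` {1..} = {z. Im z = 0} \<inter> {z. Re z \<ge> 1}"
      by (auto simp: complex_eq_iff intro!: image_eqI[where x = "Re _"])
    then show ?thesis
      by (simp add: open_Compl closed_Int closed_Collect_eq closed_Collect_le continuous_intros)
  qed
  have diff: "?f field_differentiable at z" if "z \<in> ?S - {0}" for z
  proof -
    have "(\<lambda>z. Ln (1 - z)) field_differentiable at z"
      using D that field_differentiable_def by blast
    then show ?thesis using that by (intro derivative_intros) auto
  qed
  have "0 \<in> ?S" by (auto simp: complex_eq_iff)
  \<comment> \<open>Division by zero makes \<open>?f 0 = 0\<close>, which is the true limit:
    \<open>Ln (1 - z) / z\<close> tends to -1 and the other factor to 0.\<close>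
  have "isCont ?f 0"
  proof -
    have "(\<lambda>z. (Ln (1 - z) - Ln (1 - 0)) / (z - 0)) \<midarrow>0\<rightarrow> - (1 / (1 - 0))"
      using D[OF \<open>0 \<in> ?S\<close>] by (simp add: has_field_derivative_iff)
    moreover have "(\<lambda>z. Ln (1 - z)) \<midarrow>0\<rightarrow> Ln (1 - 0)"
      using DERIV_isCont[OF D[OF \<open>0 \<in> ?S\<close>]] by (simp add: isCont_def)
    ultimately have "(\<lambda>z. (Ln (1 - z) / z) * Ln (1 - z)) \<midarrow>0\<rightarrow> - 1 * 0"
      by (intro tendsto_mult) simp_all
    then show ?thesis by (simp add: isCont_def power2_eq_square)
  qed
  then have "isCont ?f z" if "z \<in> ?S" for z
    using field_differentiable_imp_continuous_at[OF diff, of z] that by (cases "z = 0") auto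
  then have "continuous_on ?S ?f"
    by (intro continuous_at_imp_continuous_on ballI)
  from holomorphic_starlike_primitive[OF this starlike_slotted_complex_plane_right op, of "{0}"] diff
  obtain F where "\<forall>z\<in>?S. (F has_field_derivative ?f z) (at z)" by blast
  then show ?thesis using that by auto
qed

section \<open>Values of the logarithm on the unit circle and on the line Re z = 1/2\<close>

lemma one_minus_cis_polar: "1 - cis (2 * t) = of_real (2 * sin t) * cis (t - pi / 2)"
  by (simp add: complex_eq_iff sin_double cos_double_sin power2_eq_square sin_diff cos_diff)

text \<open>The angle \<open>t - pi / 2\<close> of the polar form lies in (-pi/2, pi/2), so the
  principal branch returns it unchanged.\<close>

lemma Ln_one_minus_cis:
  assumes "0 < t" "t < pi"
  shows "Ln (1 - cis (2 * t)) = Complex (ln (2 * sin t)) (t - pi / 2)"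
proof -
  have "sin t > 0" using assms by (simp add: sin_gt_zero)
  then have "1 - cis (2 * t) = exp (Complex (ln (2 * sin t)) (t - pi / 2))"
    by (simp add: one_minus_cis_polar exp_eq_polar)
  then show ?thesis using assms by (simp add: Ln_exp)
qed

lemma Ln_inverse_cis_cos:
  assumes "\<bar>t\<bar> < pi / 2"
  shows "Ln (cis (- t) / of_real (2 * cos t)) = Complex (- ln (2 * cos t)) (- t)"
proof -
  have "cos t > 0" using assms by (intro cos_gt_zero_pi) auto
  then have "cis (- t) / of_real (2 * cos t) = exp (Complex (- ln (2 * cos t)) (- t))"
    by (simp add: exp_eq_polar exp_minus field_simps)
  then show ?thesis using assms by (simp add: Ln_exp)
qed

text \<open>For |t| < pi/2 this parametrises the line Re z = 1/2 by the argument t of z; t and -t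
  give z and its conjugate 1 - z.\<close>

lemma half_plus_tan_polar:
  assumes "cos t \<noteq> 0"
  shows "Complex (1/2) (tan t / 2) = cis t / of_real (2 * cos t)"
  using assms by (simp add: complex_eq_iff tan_def Re_divide_of_real Im_divide_of_real)

section \<open>The real primitive of the squared log-sine\<close>

locale log_sine =
  fixes F :: "complex \<Rightarrow> complex"
  assumes F: "\<And>z. z \<notin> complex_of_real ` {1..} \<Longrightarrow>
    (F has_field_derivative (Ln (1 - z))\<^sup>2 / z) (at z)"
begin

text \<open>At z = exp(2it) the form Ln^2(1 - z) dz / z is 2i Ln^2(1 - z) dt, with imaginary part 2
  (ln^2(2 sin t) - (t - pi/2)^2) dt. After halving, the cubic term removes the second
  square.\<close>

definition K :: "real \<Rightarrow> real" where
  "K t = Im (F (cis (2 * t))) / 2 - (pi / 2 - t) ^ 3 / 3"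

lemma K_deriv:
  assumes "0 < t" "t < pi"
  shows "(K has_real_derivative (ln (2 * sin t))\<^sup>2) (at t)"
proof -
  have "sin t > 0" using assms by (simp add: sin_gt_zero)
  have "cis (2 * t) \<notin> complex_of_real ` {1..}"
  proof
    assume "cis (2 * t) \<in> complex_of_real ` {1..}"
    then obtain x where "x \<ge> 1" "cis (2 * t) = of_real x" by auto
    then have "cos (2 * t) \<ge> 1" by (simp add: complex_eq_iff)
    then show False using \<open>sin t > 0\<close> by (simp add: cos_double_sin)
  qed
  note d = F[OF this]
  have "((\<lambda>t. cis (2 * t)) has_vector_derivative 2 * (\<i> * cis (2 * t))) (at t)"
    unfolding has_vector_derivative_complex_iff
    by (auto intro!: derivative_eq_intros)
  from field_vector_diff_chain_at[OF this d]
  have "((\<lambda>t. F (cis (2 * t))) has_vector_derivative 2 * \<i> * (Ln (1 - cis (2 * t)))\<^sup>2) (at t)"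
    by (simp add: o_def mult_ac)
  then have "((\<lambda>t. Im (F (cis (2 * t)))) has_real_derivative Im (2 * \<i> * (Ln (1 - cis (2 * t)))\<^sup>2)) (at t)"
    by (simp add: has_vector_derivative_complex_iff)
  also have "Im (2 * \<i> * (Ln (1 - cis (2 * t)))\<^sup>2) = 2 * ((ln (2 * sin t))\<^sup>2 - (t - pi / 2)\<^sup>2)"
    by (simp add: Ln_one_minus_cis assms power2_eq_square)
  finally have 1: "((\<lambda>t. Im (F (cis (2 * t)))) has_real_derivative
      2 * ((ln (2 * sin t))\<^sup>2 - (t - pi / 2)\<^sup>2)) (at t)" .
  have 2: "((\<lambda>t. (pi / 2 - t) ^ 3 / 3) has_real_derivative - (pi / 2 - t)\<^sup>2) (at t)"
    by (auto intro!: derivative_eq_intros)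
  show ?thesis unfolding K_def[abs_def]
    by (rule DERIV_cong[OF DERIV_diff[OF DERIV_cdivide[OF 1, of 2] 2]])
      (simp add: power2_eq_square field_simps)
qed

text \<open>The derivative ln^2(2 sin t) is symmetric about pi/2, so the sum is constant.\<close>

lemma K_reflect:
  assumes "0 < t" "t < pi"
  shows "K (pi - t) + K t = 2 * K (pi / 2)"
proof -
  define f where "f = (\<lambda>t. K (pi - t) + K t)"
  have "f t = f (pi / 2)"
  proof (rule DERIV_isconst3[where f = f and x = t and y = "pi / 2" and a = 0 and b = pi])
    fix x assume "x \<in> {0<..<pi}"
    then have x: "0 < x" "x < pi" by auto
    have 1: "(K has_real_derivative (ln (2 * sin x))\<^sup>2) (at (pi - x))"
      using K_deriv[of "pi - x"] x by simp
    have 2: "((\<lambda>x. pi - x) has_real_derivative - 1) (at x)" by (auto intro!: derivative_eq_intros)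
    show "(f has_real_derivative 0) (at x)"
      using DERIV_add[OF DERIV_chain2[OF 1 2] K_deriv[OF x]] by (simp add: f_def)
  qed (use assms in auto)
  then show ?thesis by (simp add: f_def)
qed

text \<open>
  The circle closes up at \<open>z = 1\<close>: there \<open>F'\<close> has only a logarithmic singularity, so the increment
  of \<open>F\<close> along the short vertical chord next to \<open>1\<close> vanishes in the limit.
\<close>
lemma K_ends: "((\<lambda>t. K (pi - t) - K t) \<longlongrightarrow> pi ^ 3 / 12) (at_right 0)"
proof -
  \<comment> \<open>A bound for |F'| on the chord times its length \<open>2 * sin (2 * t)\<close>:
    the leading 2 comes from |z| >= 1/2, and the bracket bounds |Ln (1 - z)|, with \<open>pi\<close>
    for the imaginary part and the rest for the real part.\<close>
  let ?B = "\<lambda>t::real. 2 * (- ln (1 - cos (2 * t)) + 1 + pi)\<^sup>2 * (2 * sin (2 * t))"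
  have bound: "norm (F (cis (2 * (pi - t))) - F (cis (2 * t))) \<le> ?B t" if t: "0 < t" "t < pi / 6" for t
  proof -
    let ?s = "closed_segment (cis (2 * t)) (cis (- (2 * t)))"
    have c: "1 / 2 < cos (2 * t)" "cos (2 * t) < 1"
      using cos_monotone_0_pi[of "2 * t" "pi / 3"] cos_monotone_0_pi[of 0 "2 * t"] t
      by (auto simp: cos_60)
    have s: "sin (2 * t) > 0" using t by (intro sin_gt_zero) auto
    have "norm (F (cis (- (2 * t))) - F (cis (2 * t))) \<le>
        (2 * (- ln (1 - cos (2 * t)) + 1 + pi)\<^sup>2) * norm (cis (- (2 * t)) - cis (2 * t))"
    proof (rule field_differentiable_bound[of ?s])
      fix z assume z: "z \<in> ?s"
      then obtain u where u: "0 \<le> u" "u \<le> 1" "z = (1 - u) *\<^sub>R cis (2 * t) + u *\<^sub>R cis (- (2 * t))"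
        by (auto simp: in_segment)
      then have Re: "Re z = cos (2 * t)" unfolding u(3) by (simp add: algebra_simps)
      have "norm z \<le> 1"
        using z closed_segment_subset[of "cis (2 * t)" "cball 0 1" "cis (- (2 * t))"] by auto
      have z2: "norm z \<ge> 1 / 2" using complex_Re_le_cmod[of z] Re c by linarith
      have "z \<notin> complex_of_real ` {1..}" using Re c by auto
      then show "(F has_field_derivative (Ln (1 - z))\<^sup>2 / z) (at z within ?s)"
        using F has_field_derivative_at_within by blast
      have m: "1 - cos (2 * t) \<le> norm (1 - z)" using complex_Re_le_cmod[of "1 - z"] Re by simp
      then have nz: "norm (1 - z) > 0" "1 - z \<noteq> 0" using c by auto
      have "norm (1 - z) \<le> 2" using norm_triangle_ineq4[of 1 z] \<open>norm z \<le> 1\<close> by simp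
      then have "ln (norm (1 - z)) \<le> 1" using nz ln_le_minus_one[of "norm (1 - z)"] by linarith
      moreover have "ln (norm (1 - z)) \<ge> ln (1 - cos (2 * t))" using m c nz by (intro ln_mono) auto
      moreover have "ln (1 - cos (2 * t)) < 0" using c by simp
      ultimately have "\<bar>Re (Ln (1 - z))\<bar> \<le> - ln (1 - cos (2 * t)) + 1"
        using nz by (simp add: Re_Ln)
      moreover have "\<bar>Im (Ln (1 - z))\<bar> \<le> pi"
        using Im_Ln_le_pi[OF nz(2)] mpi_less_Im_Ln[OF nz(2)] by linarith
      ultimately have L: "norm (Ln (1 - z)) \<le> - ln (1 - cos (2 * t)) + 1 + pi"
        using cmod_le[of "Ln (1 - z)"] by linarith
      have "norm ((Ln (1 - z))\<^sup>2 / z) \<le> (- ln (1 - cos (2 * t)) + 1 + pi)\<^sup>2 / (1 / 2)"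
        unfolding norm_divide norm_power
        by (intro frac_le power_mono L z2) auto
      then show "norm ((Ln (1 - z))\<^sup>2 / z) \<le> 2 * (- ln (1 - cos (2 * t)) + 1 + pi)\<^sup>2" by simp
    qed auto
    moreover have "cis (- (2 * t)) - cis (2 * t) = of_real (2 * sin (2 * t)) * (- \<i>)"
      by (simp add: complex_eq_iff)
    moreover have "cis (2 * (pi - t)) = cis (- (2 * t))"
      by (simp add: complex_eq_iff right_diff_distrib cos_diff sin_diff)
    ultimately show ?thesis using s by (simp add: norm_mult)
  qed
  have "(?B \<longlongrightarrow> 0) (at_right 0)" by real_asymp
  then have "((\<lambda>t. F (cis (2 * (pi - t))) - F (cis (2 * t))) \<longlongrightarrow> 0) (at_right 0)"
  proof (rule Lim_null_comparison[rotated])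
    show "\<forall>\<^sub>F t in at_right 0. norm (F (cis (2 * (pi - t))) - F (cis (2 * t))) \<le> ?B t"
      using bound by (auto simp: eventually_at_right_field intro!: exI[of _ "pi / 6"])
  qed
  \<comment> \<open>The cubic terms of \<open>K (pi - t)\<close> and \<open>K t\<close> have
    opposite signs, so their difference doubles; pi^3/12 is 2/3 (pi/2)^3.\<close>
  from tendsto_Im[OF this]
  have "((\<lambda>t. Im (F (cis (2 * (pi - t))) - F (cis (2 * t))) / 2 + 2 / 3 * (pi / 2 - t) ^ 3)
     \<longlongrightarrow> 0 / 2 + 2 / 3 * (pi / 2 - 0) ^ 3) (at_right 0)"
    by (intro tendsto_intros) auto
  moreover have "Im (F (cis (2 * (pi - t))) - F (cis (2 * t))) / 2 + 2 / 3 * (pi / 2 - t) ^ 3 = K (pi - t) - K t" for t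
    unfolding K_def by (simp add: field_simps power3_eq_cube)
  moreover have "0 / 2 + 2 / 3 * (pi / 2 - 0) ^ 3 = pi ^ 3 / 12" by (simp add: power_divide)
  ultimately show ?thesis by (simp only:)
qed

text \<open>The line Re z = 1/2 meets the unit circle at exp(i pi/3) and exp(-i pi/3). The increment
  of Im F between them contains \<open>K (pi / 6) - K (5 * pi / 6)\<close> with factor 2 along the
  circle and -2 along the line, so equating the two determines it.\<close>

lemma K_sixth: "K (5 * pi / 6) - K (pi / 6) = pi ^ 3 / 54"
proof -
  let ?z = "\<lambda>t. Complex (1/2) (tan t / 2)"
  \<comment> \<open>On \<open>Re z = 1/2\<close> with \<open>t = arg z\<close>, the form \<open>Ln\<^sup>2 (1 - z) dz / z\<close> has imaginary part
    \<open>d (- t\<^sup>3/3 - t ln\<^sup>2 (2 cos t)) + 2 ln\<^sup>2 (2 cos t) dt\<close>, so \<open>N\<close> is constant.\<close>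
  define N where "N t = Im (F (?z t)) + t ^ 3 / 3 + t * (ln (2 * cos t))\<^sup>2 + 2 * K (pi / 2 - t)" for t
  have N: "(N has_real_derivative 0) (at t)" if t: "\<bar>t\<bar> < pi / 2" for t
  proof -
    have c: "cos t > 0" using t by (intro cos_gt_zero_pi) auto
    have z1: "1 - ?z t = cis (- t) / of_real (2 * cos t)"
      using half_plus_tan_polar[of "- t"] c by (simp add: complex_eq_iff)
    have "?z t \<notin> complex_of_real ` {1..}" by (auto simp: complex_eq_iff)
    note d = F[OF this]
    have "(?z has_vector_derivative Complex 0 (1 / (2 * (cos t)\<^sup>2))) (at t)"
      unfolding has_vector_derivative_complex_iff
      using c by (auto intro!: derivative_eq_intros simp: field_simps)
    from field_vector_diff_chain_at[OF this d]
    have "((\<lambda>t. F (?z t)) has_vector_derivative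
       Complex 0 (1 / (2 * (cos t)\<^sup>2)) / ?z t * (Ln (1 - ?z t))\<^sup>2) (at t)"
      by (simp add: o_def)
    \<comment> \<open>This is the logarithmic derivative of exp(it) / (2 cos t), namely i + tan
      t.\<close>
    also have "Complex 0 (1 / (2 * (cos t)\<^sup>2)) / ?z t = Complex (tan t) 1"
    proof -
      have "Complex 0 (1 / (2 * (cos t)\<^sup>2)) = Complex (tan t) 1 * ?z t"
        using c by (simp add: complex_eq_iff tan_def field_simps power2_eq_square)
      moreover have "?z t \<noteq> 0" by (simp add: complex_eq_iff)
      ultimately show ?thesis by simp
    qed
    also have "Ln (1 - ?z t) = Complex (- ln (2 * cos t)) (- t)"
      unfolding z1 using Ln_inverse_cis_cos[OF t] .
    finally have 1: "((\<lambda>t. Im (F (?z t))) has_real_derivative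
         (ln (2 * cos t))\<^sup>2 - t\<^sup>2 + 2 * t * ln (2 * cos t) * tan t) (at t)"
      by (simp add: has_vector_derivative_complex_iff power2_eq_square algebra_simps)
    have 2: "(K has_real_derivative (ln (2 * cos t))\<^sup>2) (at (pi / 2 - t))"
      using K_deriv[of "pi / 2 - t"] t by (simp add: sin_diff)
    have "((\<lambda>t. pi / 2 - t) has_real_derivative - 1) (at t)" by (auto intro!: derivative_eq_intros)
    note 3 = DERIV_chain2[OF 2 this]
    have "((\<lambda>t. (ln (2 * cos t))\<^sup>2) has_real_derivative - 2 * ln (2 * cos t) * tan t) (at t)"
      using c by (auto intro!: derivative_eq_intros simp: tan_def)
    note 4 = DERIV_mult[OF DERIV_ident this]
    have 5: "((\<lambda>t. t ^ 3 / 3) has_real_derivative t\<^sup>2) (at t)"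
      by (auto intro!: derivative_eq_intros)
    show ?thesis unfolding N_def[abs_def]
      by (rule DERIV_cong[OF DERIV_add[OF DERIV_add[OF DERIV_add[OF 1 5] 4] DERIV_cmult[OF 3, of 2]]])
        (simp add: algebra_simps)
  qed
  have "N (pi / 3) = N (- (pi / 3))"
    by (rule DERIV_isconst3[where f = N and x = "pi / 3" and y = "- (pi / 3)"
          and a = "- (pi / 2)" and b = "pi / 2"])
      (use pi_gt_zero in \<open>auto intro!: N simp del: pi_gt_zero\<close>)
  moreover have "?z (pi / 3) = cis (2 * (pi / 6))"
    using half_plus_tan_polar[of "pi / 3"] by (simp add: cos_60)
  moreover have "?z (- (pi / 3)) = cis (2 * (5 * pi / 6))"
  proof -
    have "cis (2 * (5 * pi / 6)) = cis (- (pi / 3) + 2 * pi)" by simp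
    also have "\<dots> = cis (- (pi / 3))" by (simp only: cis_mult[symmetric]) simp
    also have "\<dots> = ?z (- (pi / 3))" using half_plus_tan_polar[of "- (pi / 3)"] by (simp add: cos_60)
    finally show ?thesis by simp
  qed
  moreover have "pi / 2 - pi / 3 = pi / 6" "pi / 2 - - (pi / 3) = 5 * pi / 6" by simp_all
  \<comment> \<open>At the end points |z| = 1, so the term t ln^2(2 cos t) of \<open>N\<close> drops
    out.\<close>
  moreover have "ln (2 * cos (pi / 3)) = 0" "ln (2 * cos (- (pi / 3))) = 0"
    by (simp_all add: cos_60)
  ultimately have "Im (F (cis (2 * (pi / 6)))) + (pi / 3) ^ 3 / 3 + 2 * K (pi / 6)
      = Im (F (cis (2 * (5 * pi / 6)))) + (- (pi / 3)) ^ 3 / 3 + 2 * K (5 * pi / 6)"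
    unfolding N_def by (simp only: power_zero_numeral mult_zero_right add_0_right)
  moreover have "Im (F (cis (2 * (pi / 6)))) = 2 * K (pi / 6) + 2 * (pi / 3) ^ 3 / 3"
      "Im (F (cis (2 * (5 * pi / 6)))) = 2 * K (5 * pi / 6) - 2 * (pi / 3) ^ 3 / 3"
    unfolding K_def by (simp_all add: field_simps power3_eq_cube)
  moreover have "(- (pi / 3)) ^ 3 = - ((pi / 3) ^ 3)" "(pi / 3) ^ 3 = pi ^ 3 / 27"
    by (simp_all add: power_divide)
  ultimately show ?thesis by linarith
qed

text \<open>By reflection the increment of \<open>K\<close> over (0, pi/2) is half of pi^3/12, and
  over (pi/6, pi/2) half of pi^3/54; the difference is 7 pi^3/216.\<close>

lemma K_at_zero: "((\<lambda>t. K (pi / 6) - K t) \<longlongrightarrow> 7 * pi ^ 3 / 216) (at_right 0)"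
proof -
  have sixth: "K (pi / 6) = K (pi / 2) - pi ^ 3 / 108"
    using K_sixth K_reflect[of "pi / 6"] by simp
  have 1: "((\<lambda>t. (K (pi - t) - K t) / 2 - pi ^ 3 / 108) \<longlongrightarrow> pi ^ 3 / 12 / 2 - pi ^ 3 / 108) (at_right 0)"
    by (intro tendsto_intros K_ends) auto
  have "(K (pi - t) - K t) / 2 - pi ^ 3 / 108 = K (pi / 6) - K t" if "0 < t" "t < pi" for t
    using K_reflect[OF that] sixth by (simp add: field_simps)
  then have "\<forall>\<^sub>F t in at_right 0. (K (pi - t) - K t) / 2 - pi ^ 3 / 108 = K (pi / 6) - K t"
    unfolding eventually_at_right_field by (intro exI[of _ pi]) auto
  from Lim_transform_eventually[OF 1 this] show ?thesis by simp
qed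

end

text \<open>Hides \<open>F\<close>: the evaluation of the sum uses only these two real
  facts.\<close>

lemma log_sine_primitive:
  obtains K :: "real \<Rightarrow> real"
  where "\<And>t. 0 < t \<Longrightarrow> t < pi \<Longrightarrow> (K has_real_derivative (ln (2 * sin t))\<^sup>2) (at t)"
    and "((\<lambda>t. K (pi / 6) - K t) \<longlongrightarrow> 7 * pi ^ 3 / 216) (at_right 0)"
proof -
  obtain F where "\<And>z. z \<notin> complex_of_real ` {1..} \<Longrightarrow>
    (F has_field_derivative (Ln (1 - z))\<^sup>2 / z) (at z)" using log_sq_over_primitive by blast
  then interpret log_sine F by unfold_locales
  show thesis using that K_deriv K_at_zero by blast
qed

section \<open>Power series of powers of the arcsine\<close>

definition even_series :: "(nat \<Rightarrow> real) \<Rightarrow> real \<Rightarrow> real" where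
  "even_series a x = (\<Sum>k. a k * x ^ (2 * k))"

definition odd_primitive :: "(nat \<Rightarrow> real) \<Rightarrow> real \<Rightarrow> real" where
  "odd_primitive a x = (\<Sum>k. a k / (2 * real k + 1) * x ^ (2 * k + 1))"

text \<open>The linear bound is the growth condition imposed on all coefficient sequences below. It
  forces radius of convergence at least 1 and survives division by 2k + 1.\<close>

lemma summable_linear_bound:
  fixes a :: "nat \<Rightarrow> real"
  assumes "\<And>k. \<bar>a k\<bar> \<le> real (Suc k)" "\<bar>y\<bar> < 1"
  shows "summable (\<lambda>k. a k * y ^ k)"
proof (rule summable_comparison_test')
  show "summable (\<lambda>k. real (Suc k) * \<bar>y\<bar> ^ k)"
    using geometric_deriv_sums[of "\<bar>y\<bar>"] assms(2) by (simp add: sums_iff)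
  show "norm (a k * y ^ k) \<le> real (Suc k) * \<bar>y\<bar> ^ k" if "k \<ge> 0" for k
    unfolding real_norm_def abs_mult power_abs by (intro mult_right_mono assms(1)) simp
qed

lemma even_series_sums:
  assumes "\<And>k. \<bar>a k\<bar> \<le> real (Suc k)" "\<bar>x\<bar> < 1"
  shows "(\<lambda>k. a k * x ^ (2 * k)) sums even_series a x"
proof -
  have "summable (\<lambda>k. a k * (x\<^sup>2) ^ k)"
    using assms by (intro summable_linear_bound) (auto simp: abs_square_less_1)
  then show ?thesis unfolding even_series_def by (simp add: power_mult summable_sums)
qed

lemma linear_bound_divide:
  assumes "\<And>k. \<bar>a k\<bar> \<le> real (Suc k)"
  shows "\<bar>a k / (2 * real k + 1)\<bar> \<le> real (Suc k)"
proof -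
  have "\<bar>a k / (2 * real k + 1)\<bar> \<le> \<bar>a k\<bar> / 1"
    unfolding abs_divide by (intro divide_left_mono) auto
  then show ?thesis using assms[of k] by simp
qed

lemma odd_primitive_eq:
  assumes "\<And>k. \<bar>a k\<bar> \<le> real (Suc k)" "\<bar>x\<bar> < 1"
  shows "odd_primitive a x = x * even_series (\<lambda>k. a k / (2 * real k + 1)) x"
    and "(\<lambda>k. a k / (2 * real k + 1) * x ^ (2 * k + 1)) sums odd_primitive a x"
proof -
  have "(\<lambda>k. x * (a k / (2 * real k + 1) * x ^ (2 * k))) sums
      (x * even_series (\<lambda>k. a k / (2 * real k + 1)) x)"
    using assms by (intro sums_mult even_series_sums linear_bound_divide) auto
  then show *: "odd_primitive a x = x * even_series (\<lambda>k. a k / (2 * real k + 1)) x"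
    "(\<lambda>k. a k / (2 * real k + 1) * x ^ (2 * k + 1)) sums odd_primitive a x"
    unfolding odd_primitive_def by (simp_all add: mult_ac sums_iff)
qed

text \<open>\<open>D\<close> is the derivative of the series in y = x^2. Its expansion is given both
  as it stands and multiplied by x^2, so that coefficients of equal powers can be compared in (1 -
  x^2) D.\<close>

lemma even_series_deriv:
  assumes a: "\<And>k. \<bar>a k\<bar> \<le> real (Suc k)" and x: "\<bar>x\<bar> < 1"
  obtains D where "(even_series a has_real_derivative 2 * x * D) (at x)"
    and "(\<lambda>k. real (Suc k) * a (Suc k) * x ^ (2 * k)) sums D"
    and "(\<lambda>k. real k * a k * x ^ (2 * k)) sums (x\<^sup>2 * D)"
proof -
  define D where "D = (\<Sum>k. diffs a k * (x\<^sup>2) ^ k)"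
  have x2: "norm (x\<^sup>2) < 1" using x by (simp add: abs_square_less_1)
  have 1: "((\<lambda>y. \<Sum>k. a k * y ^ k) has_real_derivative D) (at (x\<^sup>2))"
    unfolding D_def using x2 summable_linear_bound[OF a] by (intro termdiffs_strong'[where K = 1]) auto
  have 2: "((\<lambda>x. x\<^sup>2) has_real_derivative 2 * x) (at x)" by (auto intro!: derivative_eq_intros)
  have "summable (\<lambda>k. diffs a k * (x\<^sup>2) ^ k)"
    using x2 summable_linear_bound[OF a] by (intro termdiff_converges[where K = 1]) auto
  then have s: "(\<lambda>k. diffs a k * (x\<^sup>2) ^ k) sums D" unfolding D_def by (rule summable_sums)
  then have 3: "(\<lambda>k. real (Suc k) * a (Suc k) * x ^ (2 * k)) sums D"
    by (simp add: diffs_def power_mult)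
  have "(\<lambda>k. x\<^sup>2 * (diffs a k * (x\<^sup>2) ^ k)) sums (x\<^sup>2 * D)" using s by (rule sums_mult)
  also have "(\<lambda>k. x\<^sup>2 * (diffs a k * (x\<^sup>2) ^ k)) = (\<lambda>k. real (Suc k) * a (Suc k) * x ^ (2 * Suc k))"
    by (simp only: diffs_def power_mult power_Suc) (simp only: mult_ac)
  finally have "(\<lambda>k. real (Suc k) * a (Suc k) * x ^ (2 * Suc k)) sums (x\<^sup>2 * D)" .
  from sums_Suc[OF this] have 4: "(\<lambda>k. real k * a k * x ^ (2 * k)) sums (x\<^sup>2 * D)" by simp
  have "(even_series a has_real_derivative 2 * x * D) (at x)"
    unfolding even_series_def[abs_def] power_mult
    by (rule DERIV_cong[OF DERIV_chain2[OF 1 2]]) simp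
  then show ?thesis using 3 4 that by blast
qed

text \<open>With b_k = a_k / (2k + 1), differentiating x times the even series of b gives
  coefficients (1 + 2k) b_k = a_k.\<close>

lemma odd_primitive_deriv:
  assumes a: "\<And>k. \<bar>a k\<bar> \<le> real (Suc k)" and x: "\<bar>x\<bar> < 1"
  shows "(odd_primitive a has_real_derivative even_series a x) (at x)"
proof -
  let ?b = "\<lambda>k. a k / (2 * real k + 1)"
  obtain D where D: "(even_series ?b has_real_derivative 2 * x * D) (at x)"
    and s: "(\<lambda>k. real k * ?b k * x ^ (2 * k)) sums (x\<^sup>2 * D)"
    using even_series_deriv[OF linear_bound_divide[OF a] x] by blast
  have "(\<lambda>k. ?b k * x ^ (2 * k) + 2 * (real k * ?b k * x ^ (2 * k))) sums (even_series ?b x + 2 * (x\<^sup>2 * D))"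
    by (intro sums_add sums_mult s even_series_sums linear_bound_divide a x)
  also have "(\<lambda>k. ?b k * x ^ (2 * k) + 2 * (real k * ?b k * x ^ (2 * k))) = (\<lambda>k. a k * x ^ (2 * k))"
  proof
    fix k
    have "2 * real k + 1 \<noteq> 0" by linarith
    then have "a k = (2 * real k + 1) * ?b k" by simp
    moreover have "q * y + 2 * (real k * q * y) = (2 * real k + 1) * q * y" for q y
      by (simp add: algebra_simps)
    ultimately show "?b k * x ^ (2 * k) + 2 * (real k * ?b k * x ^ (2 * k)) = a k * x ^ (2 * k)"
      by metis
  qed
  finally have eq: "even_series a x = even_series ?b x + 2 * (x\<^sup>2 * D)"
    using even_series_sums[OF a x] sums_unique2 by blast
  have "((\<lambda>x. x * even_series ?b x) has_real_derivative even_series a x) (at x)"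
    by (rule DERIV_cong[OF DERIV_mult[OF DERIV_ident D]]) (simp add: eq power2_eq_square)
  then show ?thesis
  proof (rule has_field_derivative_transform_within_open)
    show "open {-1<..<1::real}" by simp
  qed (use x odd_primitive_eq(1)[OF a] in auto)
qed

text \<open>The recurrence says that \<open>f = even_series a\<close> solves \<open>(1 - x\<^sup>2) f' = x f + x even_series e\<close>.\<close>
lemma even_series_ode:
  assumes a: "\<And>k. \<bar>a k\<bar> \<le> real (Suc k)" and e: "\<And>k. \<bar>e k\<bar> \<le> real (Suc k)"
    and rec: "\<And>k. 2 * real (Suc k) * a (Suc k) = (2 * real k + 1) * a k + e k"
    and x: "\<bar>x\<bar> < 1"
  shows "((\<lambda>x. sqrt (1 - x\<^sup>2) * even_series a x) has_real_derivative
     x * even_series e x / sqrt (1 - x\<^sup>2)) (at x)"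
proof -
  obtain D where D: "(even_series a has_real_derivative 2 * x * D) (at x)"
    and s: "(\<lambda>k. real (Suc k) * a (Suc k) * x ^ (2 * k)) sums D"
      "(\<lambda>k. real k * a k * x ^ (2 * k)) sums (x\<^sup>2 * D)"
    using even_series_deriv[OF a x] by blast
  have "(\<lambda>k. 2 * (real k * a k * x ^ (2 * k)) + a k * x ^ (2 * k) + e k * x ^ (2 * k)) sums
     (2 * (x\<^sup>2 * D) + even_series a x + even_series e x)"
    by (intro sums_add sums_mult s even_series_sums a e x)
  also have "(\<lambda>k. 2 * (real k * a k * x ^ (2 * k)) + a k * x ^ (2 * k) + e k * x ^ (2 * k))
     = (\<lambda>k. 2 * (real (Suc k) * a (Suc k) * x ^ (2 * k)))"
  proof
    fix k
    have "2 * (real (Suc k) * a (Suc k) * x ^ (2 * k)) = (2 * real (Suc k) * a (Suc k)) * x ^ (2 * k)"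
      by (simp only: mult.assoc)
    then show "2 * (real k * a k * x ^ (2 * k)) + a k * x ^ (2 * k) + e k * x ^ (2 * k)
     = 2 * (real (Suc k) * a (Suc k) * x ^ (2 * k))"
      unfolding rec by (simp add: algebra_simps)
  qed
  finally have "2 * D = 2 * (x\<^sup>2 * D) + even_series a x + even_series e x"
    using sums_mult[OF s(1), of 2] sums_unique2 by blast
  moreover have "2 * D * (1 - x\<^sup>2) = 2 * D - 2 * (x\<^sup>2 * D)" by (simp add: algebra_simps)
  ultimately have eq: "even_series e x = 2 * D * (1 - x\<^sup>2) - even_series a x" by linarith
  have pos: "1 - x\<^sup>2 > 0" using x by (simp add: abs_square_less_1)
  define r where "r = sqrt (1 - x\<^sup>2)"
  have r: "r > 0" "1 - x\<^sup>2 = r\<^sup>2" using pos by (simp_all add: r_def)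
  have "((\<lambda>x. sqrt (1 - x\<^sup>2)) has_real_derivative - x / r) (at x)"
    using pos by (auto intro!: derivative_eq_intros simp: r_def field_simps)
  from DERIV_mult[OF this D] show ?thesis
  proof (rule DERIV_cong)
    have "- x / r * even_series a x + 2 * x * D * r = x * even_series e x / r"
      unfolding eq r(2) using r(1) by (simp add: field_simps power2_eq_square)
    then show "- x / r * even_series a x + 2 * x * D * sqrt (1 - x\<^sup>2) = x * even_series e x / sqrt (1 - x\<^sup>2)"
      by (simp only: r_def)
  qed
qed

section \<open>Taylor coefficients of the arcsine and of its cube\<close>

definition arcsin_coeff :: "nat \<Rightarrow> real" where "arcsin_coeff k = pochhammer (1 / 2) k / fact k"

definition odd_harmonic :: "nat \<Rightarrow> real" where "odd_harmonic k = (\<Sum>i=1..k. 1 / (2 * real i - 1)\<^sup>2)"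

text \<open>The coefficient of x^(2k) in arcsin^2 x / (2 sqrt(1 - x^2)), the derivative of arcsin^3
  x / 6.\<close>

definition cube_coeff :: "nat \<Rightarrow> real" where "cube_coeff k = arcsin_coeff k * odd_harmonic k"

lemma arcsin_coeff_rec: "2 * real (Suc k) * arcsin_coeff (Suc k) = (2 * real k + 1) * arcsin_coeff k"
proof -
  have "2 * s * (P * (1 / 2 + r) / (s * f)) = (2 * r + 1) * (P / f)" if "s \<noteq> 0" "f \<noteq> 0" for s P r f :: real
    using that by (simp add: field_simps)
  then show ?thesis
    unfolding arcsin_coeff_def pochhammer_Suc fact_Suc
    by (simp only: of_nat_mult of_nat_fact fact_nonzero of_nat_eq_0_iff nat.simps simp_thms)
qed

lemma arcsin_coeff_bounds: "0 \<le> arcsin_coeff k" "arcsin_coeff k \<le> 1"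
proof -
  show "0 \<le> arcsin_coeff k" by (simp add: arcsin_coeff_def pochhammer_nonneg)
  show "arcsin_coeff k \<le> 1"
  proof (induction k)
    case (Suc k)
    have "2 * real (Suc k) * arcsin_coeff (Suc k) \<le> (2 * real k + 1) * 1"
      unfolding arcsin_coeff_rec using Suc by (intro mult_left_mono) auto
    also have "\<dots> \<le> 2 * real (Suc k) * 1" by simp
    finally show ?case by (rule mult_left_le_imp_le) simp
  qed (simp add: arcsin_coeff_def)
qed

text \<open>The inhomogeneous term comes from the new summand 1 / (2k + 1)^2 of
  \<open>odd_harmonic\<close>. Its odd power series is arcsin, the source term of the differential
  equation.\<close>

lemma cube_coeff_rec:
  "2 * real (Suc k) * cube_coeff (Suc k) = (2 * real k + 1) * cube_coeff k + arcsin_coeff k / (2 * real k + 1)"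
proof -
  have "2 * real (Suc k) * cube_coeff (Suc k) = (2 * real k + 1) * arcsin_coeff k * (odd_harmonic k + 1 / (2 * real k + 1)\<^sup>2)"
    unfolding cube_coeff_def mult.assoc[symmetric] arcsin_coeff_rec by (simp add: odd_harmonic_def)
  also have "\<dots> = (2 * real k + 1) * cube_coeff k + arcsin_coeff k / (2 * real k + 1)"
  proof -
    have "d * x * (y + 1 / d\<^sup>2) = d * (x * y) + x / d" for d x y :: real
      by (cases "d = 0") (simp_all add: field_simps power2_eq_square)
    then show ?thesis by (simp only: cube_coeff_def)
  qed
  finally show ?thesis .
qed

lemma cube_coeff_bounds: "0 \<le> cube_coeff k" "cube_coeff k \<le> real k"
proof -
  have "odd_harmonic k \<le> (\<Sum>i=1..k. 1)" unfolding odd_harmonic_def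
  proof (rule sum_mono)
    fix i assume "i \<in> {1..k}"
    then have "1 ^ 2 \<le> (2 * real i - 1)\<^sup>2" by (intro power_mono) auto
    moreover have "1 / y \<le> 1" if "1 ^ 2 \<le> y" for y :: real using that by (simp add: divide_le_eq_1)
    ultimately show "1 / (2 * real i - 1)\<^sup>2 \<le> 1" by blast
  qed
  moreover have "0 \<le> odd_harmonic k" unfolding odd_harmonic_def by (intro sum_nonneg) auto
  ultimately show "0 \<le> cube_coeff k" "cube_coeff k \<le> real k"
    using arcsin_coeff_bounds[of k] mult_mono[of "arcsin_coeff k" 1 "odd_harmonic k" "real k"] by (auto simp: cube_coeff_def)
qed

lemma arcsin_coeff_linear: "\<bar>arcsin_coeff k\<bar> \<le> real (Suc k)"
  using arcsin_coeff_bounds[of k] by simp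

text \<open>The bound by k, rather than k + 1, lets the shifted sequence meet the same growth
  condition.\<close>

lemma cube_coeff_linear: "\<bar>cube_coeff k\<bar> \<le> real (Suc k)" "\<bar>cube_coeff (Suc k)\<bar> \<le> real (Suc k)"
  using cube_coeff_bounds[of k] cube_coeff_bounds[of "Suc k"] by simp_all

lemma even_series_0: "even_series a 0 = a 0"
  unfolding even_series_def power_mult by simp

lemma odd_primitive_0: "odd_primitive a 0 = 0"
  unfolding odd_primitive_def by simp

text \<open>Serves to identify a series with a closed form by its derivative and its value at
  0.\<close>

lemma eq_if_same_deriv:
  fixes f u :: "real \<Rightarrow> real"
  assumes "\<And>x. \<bar>x\<bar> < 1 \<Longrightarrow> (f has_real_derivative f' x) (at x)"
    and "\<And>x. \<bar>x\<bar> < 1 \<Longrightarrow> (u has_real_derivative f' x) (at x)"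
    and "f 0 = u 0" "\<bar>x\<bar> < 1"
  shows "f x = u x"
proof -
  define d where "d = (\<lambda>x. f x - u x)"
  have "d x = d 0"
  proof (rule DERIV_isconst3[where f = d and x = x and y = 0 and a = "-1" and b = 1])
    fix y :: real assume "y \<in> {-1<..<1}"
    then have "\<bar>y\<bar> < 1" by auto
    from DERIV_diff[OF assms(1)[OF this] assms(2)[OF this]]
    show "(d has_real_derivative 0) (at y)" by (simp add: d_def)
  qed (use assms(4) in auto)
  then show ?thesis using assms(3) by (simp add: d_def)
qed

text \<open>The homogeneous case \<open>e = 0\<close> of \<open>even_series_ode\<close>: the product
  with the root is constant.\<close>

lemma even_series_arcsin_coeff:
  assumes "\<bar>x\<bar> < 1" shows "even_series arcsin_coeff x = 1 / sqrt (1 - x\<^sup>2)"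
proof -
  have "sqrt (1 - x\<^sup>2) * even_series arcsin_coeff x = 1"
  proof (rule eq_if_same_deriv[where f = "\<lambda>x. sqrt (1 - x\<^sup>2) * even_series arcsin_coeff x"
        and u = "\<lambda>_. 1" and f' = "\<lambda>_. 0"])
    fix y :: real assume y: "\<bar>y\<bar> < 1"
    have "even_series (\<lambda>_. 0) y = 0" by (simp add: even_series_def)
    then show "((\<lambda>x. sqrt (1 - x\<^sup>2) * even_series arcsin_coeff x) has_real_derivative 0) (at y)"
      using even_series_ode[of arcsin_coeff "\<lambda>_. 0", OF arcsin_coeff_linear _ _ y] arcsin_coeff_rec by simp
  qed (use assms in \<open>auto simp: even_series_0 arcsin_coeff_def\<close>)
  moreover have "sqrt (1 - x\<^sup>2) > 0" using assms by (simp add: abs_square_less_1)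
  ultimately show ?thesis by (simp add: field_simps)
qed

lemma arcsin_deriv:
  assumes "\<bar>x\<bar> < 1" shows "(arcsin has_real_derivative 1 / sqrt (1 - x\<^sup>2)) (at x)"
  using DERIV_arcsin[of x] assms by (simp add: abs_less_iff inverse_eq_divide)

lemma odd_primitive_arcsin_coeff:
  assumes "\<bar>x\<bar> < 1" shows "odd_primitive arcsin_coeff x = arcsin x"
  by (rule eq_if_same_deriv[where f' = "\<lambda>x. 1 / sqrt (1 - x\<^sup>2)"])
    (use assms odd_primitive_deriv[OF arcsin_coeff_linear] even_series_arcsin_coeff arcsin_deriv
     in \<open>auto simp: odd_primitive_0\<close>)

text \<open>The source term x times the even series of
  \<open>arcsin_coeff k / (2 * real k + 1)\<close> is arcsin x, so the product with the root has
  derivative arcsin x / sqrt(1 - x^2).\<close>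

lemma even_series_cube_coeff:
  assumes "\<bar>x\<bar> < 1" shows "even_series cube_coeff x = (arcsin x)\<^sup>2 / (2 * sqrt (1 - x\<^sup>2))"
proof -
  have "sqrt (1 - x\<^sup>2) * even_series cube_coeff x = (arcsin x)\<^sup>2 / 2"
  proof (rule eq_if_same_deriv[where f = "\<lambda>x. sqrt (1 - x\<^sup>2) * even_series cube_coeff x"
        and u = "\<lambda>x. (arcsin x)\<^sup>2 / 2" and f' = "\<lambda>x. arcsin x / sqrt (1 - x\<^sup>2)"])
    fix y :: real assume y: "\<bar>y\<bar> < 1"
    show "((\<lambda>x. sqrt (1 - x\<^sup>2) * even_series cube_coeff x) has_real_derivative arcsin y / sqrt (1 - y\<^sup>2)) (at y)"
      using even_series_ode[OF cube_coeff_linear(1) linear_bound_divide[OF arcsin_coeff_linear] cube_coeff_rec y]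
      by (simp add: odd_primitive_arcsin_coeff[OF y] odd_primitive_eq(1)[of arcsin_coeff, OF arcsin_coeff_linear y, symmetric])
    show "((\<lambda>x. (arcsin x)\<^sup>2 / 2) has_real_derivative arcsin y / sqrt (1 - y\<^sup>2)) (at y)"
      by (rule DERIV_cong[OF DERIV_cdivide[OF DERIV_power[OF arcsin_deriv[OF y]]]]) simp
  qed (use assms in \<open>auto simp: even_series_0 cube_coeff_def odd_harmonic_def\<close>)
  moreover have "sqrt (1 - x\<^sup>2) > 0" using assms by (simp add: abs_square_less_1)
  ultimately show ?thesis by (simp add: field_simps)
qed

lemma odd_primitive_cube_coeff:
  assumes "\<bar>x\<bar> < 1" shows "odd_primitive cube_coeff x = (arcsin x) ^ 3 / 6"
proof (rule eq_if_same_deriv[where f = "odd_primitive cube_coeff" and u = "\<lambda>x. (arcsin x) ^ 3 / 6"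
      and f' = "even_series cube_coeff"])
  fix y :: real assume y: "\<bar>y\<bar> < 1"
  show "(odd_primitive cube_coeff has_real_derivative even_series cube_coeff y) (at y)"
    using odd_primitive_deriv[OF cube_coeff_linear(1) y] .
  show "((\<lambda>x. (arcsin x) ^ 3 / 6) has_real_derivative even_series cube_coeff y) (at y)"
    by (rule DERIV_cong[OF DERIV_cdivide[OF DERIV_power[OF arcsin_deriv[OF y]]]])
      (simp add: even_series_cube_coeff[OF y])
qed (use assms in \<open>auto simp: odd_primitive_0\<close>)

section \<open>Evaluation of the sum\<close>

text \<open>
  The coefficients are shifted because \<open>cube_coeff 0 = 0\<close>: these are the series with general
  terms \<open>p\<^sub>k x\<^sup>2\<^sup>k\<^sup>-\<^sup>1 / (2k-1)\<close> and \<open>p\<^sub>k x\<^sup>2\<^sup>k\<^sup>-\<^sup>1 / (2k-1)\<^sup>2\<close>, \<open>k \<ge> 1\<close>.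
\<close>
definition sub_prim :: "real \<Rightarrow> real" where "sub_prim = odd_primitive (\<lambda>k. cube_coeff (Suc k))"

definition sub_prim2 :: "real \<Rightarrow> real" where
  "sub_prim2 = odd_primitive (\<lambda>k. cube_coeff (Suc k) / (2 * real k + 1))"

lemma sub_prim_deriv:
  assumes "\<bar>x\<bar> < 1" "x \<noteq> 0"
  shows "(sub_prim has_real_derivative (arcsin x)\<^sup>2 / (2 * sqrt (1 - x\<^sup>2)) / x\<^sup>2) (at x)"
proof -
  have "(\<lambda>k. x\<^sup>2 * (cube_coeff (Suc k) * x ^ (2 * k))) sums (x\<^sup>2 * even_series (\<lambda>k. cube_coeff (Suc k)) x)"
    by (intro sums_mult even_series_sums cube_coeff_linear assms)
  then have "(\<lambda>k. cube_coeff (Suc k) * x ^ (2 * Suc k)) sums (x\<^sup>2 * even_series (\<lambda>k. cube_coeff (Suc k)) x)"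
    by (simp add: power2_eq_square mult_ac)
  \<comment> \<open>The term added at k = 0 vanishes because \<open>odd_harmonic 0\<close> is an
    empty sum.\<close>
  from sums_Suc[OF this]
  have "(\<lambda>k. cube_coeff k * x ^ (2 * k)) sums (x\<^sup>2 * even_series (\<lambda>k. cube_coeff (Suc k)) x)"
    by (simp add: cube_coeff_def odd_harmonic_def)
  then have "even_series cube_coeff x = x\<^sup>2 * even_series (\<lambda>k. cube_coeff (Suc k)) x"
    using even_series_sums[OF cube_coeff_linear(1) assms(1)] sums_unique2 by blast
  then have "even_series (\<lambda>k. cube_coeff (Suc k)) x = (arcsin x)\<^sup>2 / (2 * sqrt (1 - x\<^sup>2)) / x\<^sup>2"
    using assms by (simp add: even_series_cube_coeff)
  then show ?thesis unfolding sub_prim_def using odd_primitive_deriv[OF cube_coeff_linear(2) assms(1)] by simp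
qed

lemma sub_prim2_deriv:
  assumes "\<bar>x\<bar> < 1" "x \<noteq> 0"
  shows "(sub_prim2 has_real_derivative sub_prim x / x) (at x)"
  using odd_primitive_deriv[of "\<lambda>k. cube_coeff (Suc k) / (2 * real k + 1)",
      OF linear_bound_divide[of "\<lambda>k. cube_coeff (Suc k)", OF cube_coeff_linear(2)] assms(1)]
    odd_primitive_eq(1)[of "\<lambda>k. cube_coeff (Suc k)", OF cube_coeff_linear(2) assms(1)] assms
  by (simp add: sub_prim_def sub_prim2_def)

text \<open>The weight is chosen so that the \<open>sub_prim\<close> terms cancel in the derivative
  and so that it is \<open>1\<close> at \<open>\<pi>/6\<close>.\<close>
definition log_weighted :: "real \<Rightarrow> real" where
  "log_weighted t = sub_prim2 (sin t) + (1 - ln (2 * sin t)) * sub_prim (sin t)"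

lemma sin_in_unit:
  assumes "0 < t" "t < pi / 2"
  shows "0 < sin t" "0 < cos t" "\<bar>sin t\<bar> < 1" "arcsin (sin t) = t" "sqrt (1 - (sin t)\<^sup>2) = cos t"
proof -
  show s: "0 < sin t" "0 < cos t" using assms by (auto intro: sin_gt_zero cos_gt_zero)
  have "sin t < 1" using sin_monotone_2pi[of t "pi / 2"] assms by simp
  then show "\<bar>sin t\<bar> < 1" using s by simp
  show "arcsin (sin t) = t" using assms by (intro arcsin_sin) auto
  show "sqrt (1 - (sin t)\<^sup>2) = cos t" using s by (simp add: cos_squared_eq[symmetric])
qed

lemma log_weighted_deriv:
  assumes "0 < t" "t < pi / 2"
  shows "(log_weighted has_real_derivative t\<^sup>2 / (2 * (sin t)\<^sup>2) * (1 - ln (2 * sin t))) (at t)"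
proof -
  note s = sin_in_unit[OF assms]
  have 1: "((\<lambda>t. sub_prim (sin t)) has_real_derivative t\<^sup>2 / (2 * (sin t)\<^sup>2)) (at t)"
    by (rule DERIV_cong[OF DERIV_chain2[OF sub_prim_deriv DERIV_sin]]) (use s in auto)
  have 2: "((\<lambda>t. sub_prim2 (sin t)) has_real_derivative sub_prim (sin t) / sin t * cos t) (at t)"
    by (rule DERIV_chain2[OF sub_prim2_deriv DERIV_sin]) (use s in auto)
  have 3: "((\<lambda>t. 1 - ln (2 * sin t)) has_real_derivative - (cos t / sin t)) (at t)"
    using s by (auto intro!: derivative_eq_intros)
  show ?thesis unfolding log_weighted_def[abs_def]
    by (rule DERIV_cong[OF DERIV_add[OF 2 DERIV_mult[OF 3 1]]]) (simp add: field_simps)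
qed

text \<open>The logarithm diverges, but \<open>sub_prim x / x\<close> has a finite limit at 0, so
  the spare factor sin t absorbs it.\<close>

lemma log_weighted_tendsto_0: "(log_weighted \<longlongrightarrow> 0) (at_right 0)"
proof -
  have d: "(sub_prim has_real_derivative even_series (\<lambda>k. cube_coeff (Suc k)) 0) (at 0)"
    "(sub_prim2 has_real_derivative even_series (\<lambda>k. cube_coeff (Suc k) / (2 * real k + 1)) 0) (at 0)"
    unfolding sub_prim_def sub_prim2_def by (intro odd_primitive_deriv linear_bound_divide cube_coeff_linear; simp)+
  have z: "sub_prim 0 = 0" "sub_prim2 0 = 0" by (simp_all add: sub_prim_def sub_prim2_def odd_primitive_0)
  have sin0: "filterlim (sin :: real \<Rightarrow> real) (at 0) (at_right 0)" by real_asymp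
  have "((\<lambda>x. sub_prim x / x) \<longlongrightarrow> even_series (\<lambda>k. cube_coeff (Suc k)) 0) (at 0)"
    using d(1) z by (simp add: has_field_derivative_iff)
  from filterlim_compose[OF this sin0]
  have 1: "((\<lambda>t. sub_prim (sin t) / sin t) \<longlongrightarrow> even_series (\<lambda>k. cube_coeff (Suc k)) 0) (at_right 0)" .
  have 2: "((\<lambda>t. sub_prim2 (sin t)) \<longlongrightarrow> 0) (at_right 0)"
    using filterlim_compose[OF _ sin0, of sub_prim2] DERIV_isCont[OF d(2)] z by (simp add: isCont_def)
  have 3: "((\<lambda>t::real. (1 - ln (2 * sin t)) * sin t) \<longlongrightarrow> 0) (at_right 0)" by real_asymp
  have lim: "((\<lambda>t. sub_prim2 (sin t) + (1 - ln (2 * sin t)) * sin t * (sub_prim (sin t) / sin t)) \<longlongrightarrow> 0) (at_right 0)"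
    using tendsto_add[OF 2 tendsto_mult[OF 3 1]] by simp
  show ?thesis
  proof (rule Lim_transform_eventually[OF lim])
    have "sub_prim2 (sin t) + (1 - ln (2 * sin t)) * sin t * (sub_prim (sin t) / sin t) = log_weighted t"
      if "0 < t" "t < pi / 2" for t
      using sin_in_unit(1)[OF that] by (simp add: log_weighted_def)
    then show "\<forall>\<^sub>F t in at_right 0. sub_prim2 (sin t) + (1 - ln (2 * sin t)) * sin t * (sub_prim (sin t) / sin t) = log_weighted t"
      unfolding eventually_at_right_field by (intro exI[of _ "pi / 2"]) auto
  qed
qed

text \<open>Integrating the derivative of \<open>log_weighted\<close> by parts leaves the elementary
  part \<open>q\<close> and half the log-sine integral. Only differences of \<open>K\<close> have a
  known limit at 0, hence the comparison with \<open>K (pi / 6)\<close>.\<close>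

lemma log_weighted_pi_sixth: "log_weighted (pi / 6) = 11 * pi ^ 3 / 648"
proof -
  obtain K :: "real \<Rightarrow> real" where
    K: "\<And>t. 0 < t \<Longrightarrow> t < pi \<Longrightarrow> (K has_real_derivative (ln (2 * sin t))\<^sup>2) (at t)"
    and K0: "((\<lambda>t. K (pi / 6) - K t) \<longlongrightarrow> 7 * pi ^ 3 / 216) (at_right 0)"
    using log_sine_primitive by blast
  \<comment> \<open>two integrations by parts, using \<open>(t + cot t ln (2 sin t))' = (1 - ln (2 sin t)) / sin\<^sup>2 t\<close>
    and \<open>(ln\<^sup>2 (2 sin t) / 2)' = cot t ln (2 sin t)\<close>\<close>
  define q where "q t = t\<^sup>2 / 2 * (t + cos t / sin t * ln (2 * sin t)) - t ^ 3 / 3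
    - t / 2 * (ln (2 * sin t))\<^sup>2" for t :: real
  have q: "(q has_real_derivative t\<^sup>2 / (2 * (sin t)\<^sup>2) * (1 - ln (2 * sin t))
      - (ln (2 * sin t))\<^sup>2 / 2) (at t)" if t: "0 < t" "t < pi / 2" for t
  proof -
    note s = sin_in_unit[OF t]
    have L: "((\<lambda>t. ln (2 * sin t)) has_real_derivative cos t / sin t) (at t)"
      using s by (auto intro!: derivative_eq_intros)
    have cc: "cos t * cos t = 1 - sin t * sin t" using sin_cos_squared_add3[of t] by linarith
    have C: "((\<lambda>t. cos t / sin t) has_real_derivative - 1 / (sin t)\<^sup>2) (at t)"
      using s by (auto intro!: derivative_eq_intros simp: power2_eq_square cc)
    have "((\<lambda>t. t + cos t / sin t * ln (2 * sin t)) has_real_derivative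
        (1 - ln (2 * sin t)) / (sin t)\<^sup>2) (at t)"
      by (rule DERIV_cong[OF DERIV_add[OF DERIV_ident DERIV_mult[OF C L]]])
        (use s in \<open>simp add: field_simps power2_eq_square cc\<close>)
    moreover have "((\<lambda>t. t\<^sup>2 / 2) has_real_derivative t) (at t)"
      by (auto intro!: derivative_eq_intros)
    moreover have "((\<lambda>t. t ^ 3 / 3) has_real_derivative t\<^sup>2) (at t)"
      by (auto intro!: derivative_eq_intros)
    moreover have "((\<lambda>t. t / 2) has_real_derivative 1 / 2) (at t)"
      by (auto intro!: derivative_eq_intros)
    moreover have "((\<lambda>t. (ln (2 * sin t))\<^sup>2) has_real_derivative 2 * ln (2 * sin t) * (cos t / sin t)) (at t)"
      by (rule DERIV_cong[OF DERIV_power[OF L]]) simp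
    ultimately have "(q has_real_derivative
       t * (t + cos t / sin t * ln (2 * sin t)) + (1 - ln (2 * sin t)) / (sin t)\<^sup>2 * (t\<^sup>2 / 2) - t\<^sup>2
       - (1 / 2 * (ln (2 * sin t))\<^sup>2 + 2 * ln (2 * sin t) * (cos t / sin t) * (t / 2))) (at t)"
      unfolding q_def[abs_def] by (intro DERIV_diff DERIV_mult)
    then show ?thesis
      by (rule DERIV_cong) (use s in \<open>simp add: field_simps power2_eq_square\<close>)
  qed
  have "(q \<longlongrightarrow> 0) (at_right 0)" unfolding q_def[abs_def] by real_asymp
  define f where "f = (\<lambda>t. log_weighted t - q t - K t / 2)"
  have const: "f t = f (pi / 6)" if "0 < t" "t < pi / 2" for t
  proof (rule DERIV_isconst3[where f = f and x = t and y = "pi / 6" and a = 0 and b = "pi / 2"])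
    fix x assume "x \<in> {0<..<pi / 2}"
    then have x: "0 < x" "x < pi / 2" "x < pi" by auto
    show "(f has_real_derivative 0) (at x)" unfolding f_def
      by (rule DERIV_cong[OF DERIV_diff[OF DERIV_diff[OF log_weighted_deriv[OF x(1,2)] q[OF x(1,2)]]
            DERIV_cdivide[OF K[OF x(1,3)]]]])
        simp
  qed (use that in auto)
  have "((\<lambda>t. log_weighted t - q t + (K (pi / 6) - K t) / 2) \<longlongrightarrow> 0 - 0 + 7 * pi ^ 3 / 216 / 2) (at_right 0)"
    by (intro tendsto_intros log_weighted_tendsto_0 K0 \<open>(q \<longlongrightarrow> 0) (at_right 0)\<close>) auto
  moreover have "\<forall>\<^sub>F t in at_right 0. log_weighted t - q t + (K (pi / 6) - K t) / 2 = log_weighted (pi / 6) - q (pi / 6)"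
    using const unfolding eventually_at_right_field f_def
    by (intro exI[of _ "pi / 2"]) (auto simp: diff_divide_distrib algebra_simps)
  ultimately have "((\<lambda>_. log_weighted (pi / 6) - q (pi / 6)) \<longlongrightarrow> 0 - 0 + 7 * pi ^ 3 / 216 / 2) (at_right (0::real))"
    by (rule Lim_transform_eventually)
  then have "log_weighted (pi / 6) - q (pi / 6) = 7 * pi ^ 3 / 432"
    by (simp add: tendsto_const_iff)
  \<comment> \<open>Since 2 sin(pi/6) = 1 the logarithms vanish, leaving t^3/2 - t^3/3 at t =
    pi/6.\<close>
  moreover have "q (pi / 6) = pi ^ 3 / 1296"
    unfolding q_def by (simp add: sin_30 power2_eq_square power3_eq_cube)
  ultimately show ?thesis by simp
qed

section \<open>Partial fractions of the summand and the final summation\<close>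

lemma pochhammer_neg_half: "(2 * real k - 1) * pochhammer (- (1 / 2)) k = - pochhammer (1 / 2) k"
proof (induction k)
  case (Suc k)
  have "(2 * real (Suc k) - 1) * pochhammer (- (1 / 2)) (Suc k)
     = (2 * real k + 1) / 2 * ((2 * real k - 1) * pochhammer (- (1 / 2)) k)"
    by (simp add: pochhammer_Suc algebra_simps)
  then show ?case unfolding Suc by (simp add: pochhammer_Suc field_simps)
qed simp

text \<open>Splitting off the first and the last factor of (1/2)_(k+1) gives two expressions to
  compare.\<close>

lemma pochhammer_three_halves: "pochhammer (3 / 2) k = (2 * real k + 1) * pochhammer (1 / 2) k"
  using pochhammer_rec[of "1 / 2 :: real" k] pochhammer_rec'[of "1 / 2 :: real" k]
  by (simp add: field_simps)

text \<open>The Pochhammer quotient leaves the rational factor (6k - 1) / ((2k - 1)^2 (2k + 1)),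
  decomposed in terms of u = 2k - 1.\<close>

lemma summand_partial_fractions:
  assumes "k \<ge> 1"
  shows "(6 * real k - 1) * (pochhammer (- (1 / 2)) k)\<^sup>2 / (4 ^ k * fact k * pochhammer (3 / 2) k) * odd_harmonic k
    = cube_coeff k / 4 ^ k * (1 / (2 * real k - 1) + 1 / (2 * real k - 1)\<^sup>2 - 1 / (2 * real k + 1))"
proof -
  define u where "u = 2 * real k - 1"
  have u: "u > 0" using assms by (simp add: u_def)
  have k: "6 * real k - 1 = 3 * u + 2" "2 * real k + 1 = u + 2" by (simp_all add: u_def)
  define P where "P = pochhammer (1 / 2 :: real) k"
  have P: "P > 0" unfolding P_def by (intro pochhammer_pos) simp
  have "u * pochhammer (- (1 / 2)) k = - P"
    using pochhammer_neg_half[of k] unfolding u_def P_def .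
  then have 1: "pochhammer (- (1 / 2)) k = - P / u" using u by (simp add: field_simps)
  have 2: "pochhammer (3 / 2) k = (u + 2) * P"
    unfolding pochhammer_three_halves P_def k ..
  have 3: "1 / u + 1 / u\<^sup>2 - 1 / (u + 2) = (3 * u + 2) / (u\<^sup>2 * (u + 2))"
    using u by (simp add: field_simps power2_eq_square)
  have alg: "m * (- P / u)\<^sup>2 / (q * F * (v * P)) * H = P / F * H / q * (m / (u\<^sup>2 * v))"
    if "u \<noteq> 0" "v \<noteq> 0" "P \<noteq> 0" "q \<noteq> 0" "F \<noteq> 0" for u v P q F m H :: real
    using that by (simp add: power2_eq_square mult_ac)
  show ?thesis
    unfolding k u_def[symmetric] 1 2 3 cube_coeff_def arcsin_coeff_def P_def[symmetric]
    using alg[of u "u + 2" P "4 ^ k" "fact k" "3 * u + 2" "odd_harmonic k"] u P by simp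
qed

theorem theorem2p1:
  "(\<lambda>n. let k = Suc n in
      (6 * real k - 1) * (pochhammer (- (1/2)) k)\<^sup>2 / (4 ^ k * fact k * pochhammer (3/2) k)
        * (\<Sum>i=1..k. 1 / (2 * real i - 1)\<^sup>2))
    sums (pi ^ 3 / 144)"
proof -
  let ?d = "\<lambda>n. 2 * real n + 1"
  have "(\<lambda>n. cube_coeff (Suc n) / ?d n * (1 / 2) ^ (2 * n + 1)) sums sub_prim (1 / 2)"
    unfolding sub_prim_def by (intro odd_primitive_eq(2) cube_coeff_linear) simp
  moreover have "(\<lambda>n. cube_coeff (Suc n) / ?d n / ?d n * (1 / 2) ^ (2 * n + 1)) sums sub_prim2 (1 / 2)"
    unfolding sub_prim2_def by (intro odd_primitive_eq(2) linear_bound_divide cube_coeff_linear) simp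
  moreover have "(\<lambda>n. cube_coeff (Suc n) / (2 * real (Suc n) + 1) * (1 / 2) ^ (2 * Suc n + 1))
      sums odd_primitive cube_coeff (1 / 2)"
  proof -
    have "(\<lambda>k. cube_coeff k / (2 * real k + 1) * (1 / 2) ^ (2 * k + 1)) sums odd_primitive cube_coeff (1 / 2)"
      by (intro odd_primitive_eq(2) cube_coeff_linear) simp
    then show ?thesis by (subst sums_Suc_iff) (simp add: cube_coeff_def odd_harmonic_def)
  qed
  \<comment> \<open>The weights 1/2 and 2 turn (1/2)^(2k-1) and (1/2)^(2k+1), where k = n + 1, into
    1/4^k.\<close>
  ultimately have "(\<lambda>n. (cube_coeff (Suc n) / ?d n * (1 / 2) ^ (2 * n + 1)
      + cube_coeff (Suc n) / ?d n / ?d n * (1 / 2) ^ (2 * n + 1)) / 2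
      - 2 * (cube_coeff (Suc n) / (2 * real (Suc n) + 1) * (1 / 2) ^ (2 * Suc n + 1)))
    sums ((sub_prim (1 / 2) + sub_prim2 (1 / 2)) / 2 - 2 * odd_primitive cube_coeff (1 / 2))"
    by (intro sums_diff sums_divide sums_add sums_mult)
  moreover have "sub_prim (1 / 2) + sub_prim2 (1 / 2) = 11 * pi ^ 3 / 648"
    using log_weighted_pi_sixth by (simp add: log_weighted_def sin_30)
  moreover have "odd_primitive cube_coeff (1 / 2) = (pi / 6) ^ 3 / 6"
  proof -
    have "arcsin (1 / 2) = pi / 6" using arcsin_sin[of "pi / 6"] by (simp add: sin_30)
    then show ?thesis by (simp add: odd_primitive_cube_coeff)
  qed
  \<comment> \<open>In units of pi^3/1296 this reads 11 - 2 = 9.\<close>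
  moreover have "11 * pi ^ 3 / 648 / 2 - 2 * ((pi / 6) ^ 3 / 6) = pi ^ 3 / 144"
    by (simp add: power_divide)
  ultimately have "(\<lambda>n. (cube_coeff (Suc n) / ?d n * (1 / 2) ^ (2 * n + 1)
      + cube_coeff (Suc n) / ?d n / ?d n * (1 / 2) ^ (2 * n + 1)) / 2
      - 2 * (cube_coeff (Suc n) / (2 * real (Suc n) + 1) * (1 / 2) ^ (2 * Suc n + 1))) sums (pi ^ 3 / 144)"
    by (simp only:)
  moreover have "(cube_coeff (Suc n) / ?d n * (1 / 2) ^ (2 * n + 1)
      + cube_coeff (Suc n) / ?d n / ?d n * (1 / 2) ^ (2 * n + 1)) / 2
      - 2 * (cube_coeff (Suc n) / (2 * real (Suc n) + 1) * (1 / 2) ^ (2 * Suc n + 1))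
    = cube_coeff (Suc n) / 4 ^ Suc n * (1 / (2 * real (Suc n) - 1) + 1 / (2 * real (Suc n) - 1)\<^sup>2
       - 1 / (2 * real (Suc n) + 1))" for n
  proof -
    have "(1 / 2 :: real) ^ (2 * n + 1) = 2 / 4 ^ Suc n" "(1 / 2 :: real) ^ (2 * Suc n + 1) = 1 / 2 / 4 ^ Suc n"
      by (simp_all add: power_mult power_divide)
    moreover have "2 * real (Suc n) - 1 = ?d n" by simp
    moreover have "(x / d * (2 / y) + x / d / d * (2 / y)) / 2 - 2 * (x / e * (1 / 2 / y))
        = x / y * (1 / d + 1 / d\<^sup>2 - 1 / e)" for x y d e :: real
      by (simp add: power2_eq_square add_divide_distrib distrib_left right_diff_distrib mult_ac)
    ultimately show ?thesis by (simp only:)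
  qed
  ultimately show ?thesis
    using summand_partial_fractions[of "Suc n" for n] by (simp add: Let_def odd_harmonic_def)
qed

end
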